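(* Let $(\Sigma_N,\nu_N,H_N)_{N\ge1}$ be a disordered system as in the context, with free energies $F_N$ and Gibbs averages $\langle\cdot\rangle_\beta$. Let $\beta>0$ and $\delta>0$ be fixed, and suppose there is a nonrandom function $F:(\beta-\delta,\beta+\delta)\to\mathbb{R}$ such that for every $\beta'\in(\beta-\delta,\beta+\delta)$, $\lim_{N\to\infty}F_N(\beta')=F(\beta')$ almost surely. Assume that $F$ is differentiable at $\beta$. Then $$\lim_{N\to\infty}\Bigl\langle\Bigl|\frac{H_N(\sigma)}{N}-F'(\beta)\Bigr|\Bigr\rangle_\beta=0\quad\text{almost surely}.$$
   Context: Setting. All random objects are defined on one probability space $(\Omega,\mathcal{A},\mathbb{P})$ with expectation $\mathbb{E}$. For each $N\ge1$, $(\Sigma_N,\mathcal{F}_N)$ is a measurable space, $\nu_N$ is a random probability measure on it, and the Hamiltonian $H_N=(H_N(\sigma))_{\sigma\in\Sigma_N}$ is a real-valued stochastic process indexed by $\Sigma_N$ (jointly measurable in the randomness and $\sigma$), such that $$\mathbb{E}\int_{\Sigma_N}\exp\bigl(b|H_N(\sigma)|\bigr)\,\nu_N(d\sigma)<\infty\quad\text{for all } b>0.$$ For real $b$, the partition function and free energy are the random objects $$Z_N(b)=\int_{\Sigma_N}e^{bH_N(\sigma)}\,\nu_N(d\sigma),\qquad F_N(b)=\frac1N\log Z_N(b),$$ and the Gibbs average of an integrable function $\Psi:\Sigma_N\to\mathbb{R}$ is $$\langle\Psi\rangle_b=\frac{1}{Z_N(b)}\int_{\Sigma_N}\Psi(\sigma)\,e^{bH_N(\sigma)}\,\nu_N(d\sigma).$$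 By the integrability assumption, almost surely $0<Z_N(b)<\infty$ for all real $b$. *)

theory Defs
  imports "HOL-Probability.Probability"
begin

text \<open>
  The configuration spaces \<open>S N\<close> share one carrier type \<open>'s\<close>, but each has its own underlying set
  and sigma-algebra. A random probability measure on \<open>S N\<close> is a probability kernel from \<open>M\<close> to
  \<open>S N\<close>. The sequence is indexed by \<open>N \<ge> 1\<close>; nothing is required at \<open>N = 0\<close>.
\<close>

locale disordered_system = prob_space M
  for M :: "'w measure" +
  fixes S :: "nat \<Rightarrow> 's measure"
    and nu :: "nat \<Rightarrow> 'w \<Rightarrow> 's measure"
    and H :: "nat \<Rightarrow> 'w \<Rightarrow> 's \<Rightarrow> real"
  assumes random_prob_measure:
      "\<And>N. N \<ge> 1 \<Longrightarrow> nu N \<in> M \<rightarrow>\<^sub>M prob_algebra (S N)"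
    and hamiltonian_measurable:
      "\<And>N. N \<ge> 1 \<Longrightarrow> (\<lambda>(\<omega>, \<sigma>). H N \<omega> \<sigma>) \<in> borel_measurable (M \<Otimes>\<^sub>M S N)"
    and exp_moments:
      "\<And>N b. N \<ge> 1 \<Longrightarrow> b > 0 \<Longrightarrow>
        (\<integral>\<^sup>+ \<omega>. (\<integral>\<^sup>+ \<sigma>. ennreal (exp (b * \<bar>H N \<omega> \<sigma>\<bar>)) \<partial>nu N \<omega>) \<partial>M) < \<infinity>"

text \<open>
  The integrals below are Bochner integrals, which are 0 for non-integrable integrands;
  \<open>AE_partition_function\<close> shows that this convention matters only on a null set of \<open>\<omega>\<close>,
  uniformly in \<open>N\<close> and \<open>b\<close>.
\<close>

definition partition_function ::
  "(nat \<Rightarrow> 'w \<Rightarrow> 's measure) \<Rightarrow> (nat \<Rightarrow> 'w \<Rightarrow> 's \<Rightarrow> real) \<Rightarrow> nat \<Rightarrow> real \<Rightarrow> 'w \<Rightarrow> real"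
  where "partition_function nu H N b \<omega> = (\<integral>\<sigma>. exp (b * H N \<omega> \<sigma>) \<partial>nu N \<omega>)"

definition free_energy ::
  "(nat \<Rightarrow> 'w \<Rightarrow> 's measure) \<Rightarrow> (nat \<Rightarrow> 'w \<Rightarrow> 's \<Rightarrow> real) \<Rightarrow> nat \<Rightarrow> real \<Rightarrow> 'w \<Rightarrow> real"
  where "free_energy nu H N b \<omega> = 1 / real N * ln (partition_function nu H N b \<omega>)"

definition gibbs_average ::
  "(nat \<Rightarrow> 'w \<Rightarrow> 's measure) \<Rightarrow> (nat \<Rightarrow> 'w \<Rightarrow> 's \<Rightarrow> real) \<Rightarrow> nat \<Rightarrow> real \<Rightarrow> 'w \<Rightarrow>
    ('s \<Rightarrow> real) \<Rightarrow> real"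
  where "gibbs_average nu H N b \<omega> \<Psi> =
    1 / partition_function nu H N b \<omega> * (\<integral>\<sigma>. \<Psi> \<sigma> * exp (b * H N \<omega> \<sigma>) \<partial>nu N \<omega>)"

context disordered_system
begin

lemma AE_exp_abs_finite:
  assumes N: "N \<ge> 1"
  shows "AE \<omega> in M. \<forall>k::nat. (\<integral>\<^sup>+ \<sigma>. ennreal (exp (real (Suc k) * \<bar>H N \<omega> \<sigma>\<bar>)) \<partial>nu N \<omega>) < \<infinity>"
proof -
  have "AE \<omega> in M. (\<integral>\<^sup>+ \<sigma>. ennreal (exp (real (Suc k) * \<bar>H N \<omega> \<sigma>\<bar>)) \<partial>nu N \<omega>) < \<infinity>" for k
  proof -
    note hamiltonian_measurable[OF N, measurable]
    have kernel: "nu N \<in> M \<rightarrow>\<^sub>M subprob_algebra (S N)"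
      using random_prob_measure[OF N] by (rule measurable_prob_algebraD)
    have "(\<lambda>\<omega>. \<integral>\<^sup>+ \<sigma>. ennreal (exp (real (Suc k) * \<bar>H N \<omega> \<sigma>\<bar>)) \<partial>nu N \<omega>) \<in> borel_measurable M"
      by (rule nn_integral_measurable_subprob_algebra2[OF _ kernel])
        (use hamiltonian_measurable[OF N] in \<open>simp add: split_beta'\<close>)
    then show ?thesis
      using nn_integral_PInf_AE[of _ M] exp_moments[OF N, of "real (Suc k)"]
      by (auto simp: less_top)
  qed
  then show ?thesis by (subst AE_all_countable) blast
qed

lemma AE_partition_function:
  "AE \<omega> in M. \<forall>N\<ge>1. \<forall>b. integrable (nu N \<omega>) (\<lambda>\<sigma>. exp (b * H N \<omega> \<sigma>)) \<and>
    0 < partition_function nu H N b \<omega>"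
proof -
  have "AE \<omega> in M. N \<ge> 1 \<longrightarrow> (\<forall>b. integrable (nu N \<omega>) (\<lambda>\<sigma>. exp (b * H N \<omega> \<sigma>)) \<and>
    0 < partition_function nu H N b \<omega>)" for N
  proof (cases "N \<ge> 1")
    case N: True
    show ?thesis
      using AE_exp_abs_finite[OF N] AE_space
    proof eventually_elim
      case (elim \<omega>)
      have nu: "prob_space (nu N \<omega>)" "sets (nu N \<omega>) = sets (S N)"
        using measurable_space[OF random_prob_measure[OF N] elim(2)]
        by (auto simp: space_prob_algebra)
      interpret nu: prob_space "nu N \<omega>" by (rule nu)
      have meas: "H N \<omega> \<in> borel_measurable (nu N \<omega>)"
        using measurable_Pair2[OF hamiltonian_measurable[OF N] elim(2)]
        by (simp add: measurable_cong_sets[OF nu(2) refl])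
      have int: "integrable (nu N \<omega>) (\<lambda>\<sigma>. exp (b * H N \<omega> \<sigma>))" for b
      proof -
        obtain k :: nat where k: "\<bar>b\<bar> \<le> real (Suc k)"
          by (metis order.trans real_arch_simple lessI less_imp_le of_nat_le_iff)
        have "integrable (nu N \<omega>) (\<lambda>\<sigma>. exp (real (Suc k) * \<bar>H N \<omega> \<sigma>\<bar>))"
          using elim(1) meas by (intro integrableI_nonneg) auto
        then show ?thesis
        proof (rule Bochner_Integration.integrable_bound)
          show "(\<lambda>\<sigma>. exp (b * H N \<omega> \<sigma>)) \<in> borel_measurable (nu N \<omega>)"
            using meas by measurable
          have "b * h \<le> real (Suc k) * \<bar>h\<bar>" for h
          proof -
            have "b * h \<le> \<bar>b\<bar> * \<bar>h\<bar>" by (metis abs_ge_self abs_mult)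
            also have "\<dots> \<le> real (Suc k) * \<bar>h\<bar>" using k by (rule mult_right_mono) simp
            finally show ?thesis .
          qed
          then show "AE \<sigma> in nu N \<omega>. norm (exp (b * H N \<omega> \<sigma>))
              \<le> norm (exp (real (Suc k) * \<bar>H N \<omega> \<sigma>\<bar>))"
            by (simp del: of_nat_Suc)
        qed
      qed
      have "0 < partition_function nu H N b \<omega>" for b
      proof -
        have "partition_function nu H N b \<omega> \<noteq> 0"
          unfolding partition_function_def
          using nu.prob_space
          by (subst integral_nonneg_eq_0_iff_AE[OF int]) (auto simp: nu.AE_False)
        then show ?thesis
          by (simp add: partition_function_def order_less_le)
      qed
      with int show ?case by blast
    qed
  qed simp
  then show ?thesis by (subst AE_all_countable) blast
qed

end

end

theory Submission
  imports Defs
begin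

text \<open>
  Fix a realization. With \<open>y = H/N - c\<close>, \<open>c = F'(\<beta>)\<close>, the inequality \<open>u \<le> exp u\<close> gives
  \<open>\<bar>y\<bar> \<le> \<epsilon> + exp (s N (\<bar>y\<bar> - \<epsilon>)) / (s N)\<close> for every \<open>s > 0\<close>, and the Gibbs averages of
  \<open>exp (\<plusminus> s N y)\<close> are \<open>exp (N (F\<^sub>N(\<beta> \<plusminus> s) - F\<^sub>N(\<beta>) \<mp> s c))\<close>. For \<open>s\<close> small the limit exponents
  \<open>F(\<beta> \<plusminus> s) - F(\<beta>) \<mp> s c\<close> are below \<open>s \<epsilon>\<close>, so the Gibbs average of \<open>\<bar>y\<bar>\<close> is eventually at most
  \<open>\<epsilon> + 2 / (s N)\<close>. Only the countably many parameters \<open>s = \<delta> / (k + 2)\<close> are needed, which takes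
  care of the null sets.
\<close>

lemma partition_function_eq_exp_free_energy:
  assumes "N \<ge> 1" and "0 < partition_function nu H N b \<omega>"
  shows "partition_function nu H N b \<omega> = exp (real N * free_energy nu H N b \<omega>)"
  using assms by (simp add: free_energy_def)

text \<open>Tilting the Gibbs weight by \<open>exp (s * H)\<close> or \<open>exp (- s * H)\<close>
  only shifts the inverse temperature to \<beta> + s or \<beta> - s. An exponential bound on the
  deviation therefore becomes, for each fixed \<open>N\<close>, a bound by free energy
  differences.\<close>

lemma gibbs_average_abs_deviation_le:
  fixes c s \<epsilon> \<beta> :: real
  assumes N: "N \<ge> 1" and s: "s > 0" and \<epsilon>: "\<epsilon> > 0"
    and int: "\<And>b. integrable (nu N \<omega>) (\<lambda>\<sigma>. exp (b * H N \<omega> \<sigma>))"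
    and pos: "\<And>b. 0 < partition_function nu H N b \<omega>"
  shows "gibbs_average nu H N \<beta> \<omega> (\<lambda>\<sigma>. \<bar>H N \<omega> \<sigma> / real N - c\<bar>) \<le> \<epsilon> +
    (exp (real N * (free_energy nu H N (\<beta> + s) \<omega> - free_energy nu H N \<beta> \<omega> - s * c - s * \<epsilon>)) +
     exp (real N * (free_energy nu H N (\<beta> - s) \<omega> - free_energy nu H N \<beta> \<omega> + s * c - s * \<epsilon>)))
    / (s * real N)"
    (is "_ \<le> \<epsilon> + (?E1 + ?E2) / _")
proof -
  let ?Z = "\<lambda>b. partition_function nu H N b \<omega>"
  let ?n = "real N"
  have n: "?n > 0" using N by simp
  \<comment> \<open>Expanding \<open>s * N * (y - \<epsilon>)\<close> and
    \<open>s * N * (- y - \<epsilon>)\<close> gives the term \<open>s * h\<close> or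
    \<open>- s * h\<close> plus a constant; \<open>A\<close> and \<open>B\<close> collect these
    constants together with the factor \<open>1 / (s * N)\<close>.\<close>
  define A where "A = exp (- ?n * (s * c + s * \<epsilon>)) / (s * ?n)"
  define B where "B = exp (?n * (s * c - s * \<epsilon>)) / (s * ?n)"
  define g where "g = (\<lambda>\<sigma>. \<epsilon> * exp (\<beta> * H N \<omega> \<sigma>) +
    (A * exp ((\<beta> + s) * H N \<omega> \<sigma>) + B * exp ((\<beta> - s) * H N \<omega> \<sigma>)))"
  have AB: "A \<ge> 0" "B \<ge> 0" using s n by (auto simp: A_def B_def)
  have pointwise: "\<bar>h / ?n - c\<bar> * exp (\<beta> * h) \<le> \<epsilon> * exp (\<beta> * h) +
    (A * exp ((\<beta> + s) * h) + B * exp ((\<beta> - s) * h))" for h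
  proof -
    define y where "y = h / ?n - c"
    have h: "h = ?n * (y + c)" using n by (simp add: y_def)
    have "s * ?n * (\<bar>y\<bar> - \<epsilon>) \<le> exp (s * ?n * (\<bar>y\<bar> - \<epsilon>))"
      using exp_ge_add_one_self[of "s * ?n * (\<bar>y\<bar> - \<epsilon>)"] by linarith
    \<comment> \<open>One of the two summands equals the exponential with the absolute value, and
      the other is positive.\<close>
    also have "\<dots> \<le> exp (s * ?n * (y - \<epsilon>)) + exp (s * ?n * (- y - \<epsilon>))"
      by (cases "y \<ge> 0") simp_all
    finally have "\<bar>y\<bar> \<le> \<epsilon> + (exp (s * ?n * (y - \<epsilon>)) + exp (s * ?n * (- y - \<epsilon>))) / (s * ?n)"
      using s n by (simp add: field_simps)
    then have "\<bar>y\<bar> * exp (\<beta> * h) \<le>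
        (\<epsilon> + (exp (s * ?n * (y - \<epsilon>)) + exp (s * ?n * (- y - \<epsilon>))) / (s * ?n)) * exp (\<beta> * h)"
      by (rule mult_right_mono) simp
    also have "\<dots> = \<epsilon> * exp (\<beta> * h) + (exp (s * ?n * (y - \<epsilon>) + \<beta> * h) / (s * ?n)
        + exp (s * ?n * (- y - \<epsilon>) + \<beta> * h) / (s * ?n))"
      by (simp add: exp_add distrib_right add_divide_distrib)
    also have "exp (s * ?n * (y - \<epsilon>) + \<beta> * h) / (s * ?n) = A * exp ((\<beta> + s) * h)"
      unfolding A_def times_divide_eq_left exp_add[symmetric] h by (simp add: algebra_simps)
    also have "exp (s * ?n * (- y - \<epsilon>) + \<beta> * h) / (s * ?n) = B * exp ((\<beta> - s) * h)"
      unfolding B_def times_divide_eq_left exp_add[symmetric] h by (simp add: algebra_simps)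
    finally show ?thesis by (simp add: y_def)
  qed
  \<comment> \<open>Integrability and nonnegativity of the majorant \<open>g\<close> suffice: if the
    left integrand were not integrable, its Bochner integral would be 0.\<close>
  have "(\<integral>\<sigma>. \<bar>H N \<omega> \<sigma> / ?n - c\<bar> * exp (\<beta> * H N \<omega> \<sigma>) \<partial>nu N \<omega>) \<le> (\<integral>\<sigma>. g \<sigma> \<partial>nu N \<omega>)"
    using int pointwise AB \<epsilon> by (intro integral_mono') (auto simp: g_def)
  also have "\<dots> = \<epsilon> * ?Z \<beta> + (A * ?Z (\<beta> + s) + B * ?Z (\<beta> - s))"
    unfolding g_def partition_function_def using int by simp
  finally have "gibbs_average nu H N \<beta> \<omega> (\<lambda>\<sigma>. \<bar>H N \<omega> \<sigma> / ?n - c\<bar>)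
      \<le> (\<epsilon> * ?Z \<beta> + (A * ?Z (\<beta> + s) + B * ?Z (\<beta> - s))) / ?Z \<beta>"
    using pos[of \<beta>] by (simp add: gibbs_average_def divide_right_mono)
  also have "\<dots> = \<epsilon> + (A * (?Z (\<beta> + s) / ?Z \<beta>) + B * (?Z (\<beta> - s) / ?Z \<beta>))"
    using pos[of \<beta>] by (simp add: add_divide_distrib)
  also have "A * (?Z (\<beta> + s) / ?Z \<beta>) = ?E1 / (s * ?n)"
    unfolding partition_function_eq_exp_free_energy[OF N pos] exp_diff[symmetric] A_def
      times_divide_eq_left exp_add[symmetric] by (simp add: algebra_simps)
  also have "B * (?Z (\<beta> - s) / ?Z \<beta>) = ?E2 / (s * ?n)"
    unfolding partition_function_eq_exp_free_energy[OF N pos] exp_diff[symmetric] B_def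
      times_divide_eq_left exp_add[symmetric] by (simp add: algebra_simps)
  finally show ?thesis by (simp add: add_divide_distrib)
qed

text \<open>A single fixed \<open>s\<close> suffices for a given \<epsilon>: the strict inequalities
  at \<beta> + s and \<beta> - s pass from \<open>F\<close> to the free energies for large
  \<open>N\<close>.\<close>

lemma gibbs_average_abs_deviation_eventually_less:
  fixes c s \<epsilon> \<beta> :: real
  assumes s: "s > 0" and \<epsilon>: "\<epsilon> > 0"
    and int: "\<And>N b. N \<ge> 1 \<Longrightarrow> integrable (nu N \<omega>) (\<lambda>\<sigma>. exp (b * H N \<omega> \<sigma>))"
    and pos: "\<And>N b. N \<ge> 1 \<Longrightarrow> 0 < partition_function nu H N b \<omega>"
    and lim: "\<And>b. b \<in> {\<beta>, \<beta> + s, \<beta> - s} \<Longrightarrow> (\<lambda>N. free_energy nu H N b \<omega>) \<longlonglongrightarrow> F b"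
    and right: "F (\<beta> + s) - F \<beta> - s * c < s * \<epsilon>"
    and left: "F (\<beta> - s) - F \<beta> + s * c < s * \<epsilon>"
  shows "\<forall>\<^sub>F N in sequentially.
    gibbs_average nu H N \<beta> \<omega> (\<lambda>\<sigma>. \<bar>H N \<omega> \<sigma> / real N - c\<bar>) < 2 * \<epsilon>"
proof -
  let ?f = "\<lambda>N b. free_energy nu H N b \<omega>"
  have "(\<lambda>N. ?f N (\<beta> + s) - ?f N \<beta> - s * c) \<longlonglongrightarrow> F (\<beta> + s) - F \<beta> - s * c"
    by (intro tendsto_intros lim) auto
  then have right_ev: "\<forall>\<^sub>F N in sequentially. ?f N (\<beta> + s) - ?f N \<beta> - s * c < s * \<epsilon>"
    using right by (rule order_tendstoD)
  have "(\<lambda>N. ?f N (\<beta> - s) - ?f N \<beta> + s * c) \<longlonglongrightarrow> F (\<beta> - s) - F \<beta> + s * c"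
    by (intro tendsto_intros lim) auto
  then have left_ev: "\<forall>\<^sub>F N in sequentially. ?f N (\<beta> - s) - ?f N \<beta> + s * c < s * \<epsilon>"
    using left by (rule order_tendstoD)
  have "(\<lambda>N. (2 / s) / real N) \<longlonglongrightarrow> 0"
    by (rule lim_const_over_n)
  then have "\<forall>\<^sub>F N in sequentially. (2 / s) / real N < \<epsilon>"
    using \<epsilon> by (rule order_tendstoD)
  with right_ev left_ev eventually_ge_at_top[of 1] show ?thesis
  proof eventually_elim
    case (elim N)
    let ?E1 = "exp (real N * (?f N (\<beta> + s) - ?f N \<beta> - s * c - s * \<epsilon>))"
    let ?E2 = "exp (real N * (?f N (\<beta> - s) - ?f N \<beta> + s * c - s * \<epsilon>))"
    have "gibbs_average nu H N \<beta> \<omega> (\<lambda>\<sigma>. \<bar>H N \<omega> \<sigma> / real N - c\<bar>)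
        \<le> \<epsilon> + (?E1 + ?E2) / (s * real N)"
      using elim(3) s \<epsilon> int pos by (intro gibbs_average_abs_deviation_le) auto
    \<comment> \<open>By \<open>right_ev\<close> and \<open>left_ev\<close> both exponents are
      negative, so each exponential is at most 1.\<close>
    also have "\<dots> \<le> \<epsilon> + (1 + 1) / (s * real N)"
      using elim s
      by (intro add_left_mono divide_right_mono add_mono) (auto simp: mult_le_0_iff)
    also have "\<dots> < 2 * \<epsilon>" using elim(4) by simp
    finally show ?case .
  qed
qed

text \<open>This is the limit of the difference quotient, multiplied by
  \<open>\<bar>s\<bar>\<close>. Both signs of \<open>s\<close> are covered, so one \<open>d\<close>
  serves the shifts to either side.\<close>

lemma has_real_derivative_increment_bound:
  fixes F :: "real \<Rightarrow> real"
  assumes F: "(F has_real_derivative c) (at x)" and \<epsilon>: "\<epsilon> > 0"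
  shows "\<exists>d>0. \<forall>s. s \<noteq> 0 \<and> \<bar>s\<bar> < d \<longrightarrow> \<bar>F (x + s) - F x - s * c\<bar> < \<bar>s\<bar> * \<epsilon>"
proof -
  have "(\<lambda>s. (F (x + s) - F x) / s) \<midarrow>0\<rightarrow> c"
    using F by (simp add: DERIV_def)
  from LIM_D[OF this \<epsilon>] obtain d where d: "d > 0"
    "\<And>s. s \<noteq> 0 \<Longrightarrow> \<bar>s\<bar> < d \<Longrightarrow> \<bar>(F (x + s) - F x) / s - c\<bar> < \<epsilon>"
    by auto
  have "\<bar>F (x + s) - F x - s * c\<bar> < \<bar>s\<bar> * \<epsilon>" if "s \<noteq> 0" "\<bar>s\<bar> < d" for s
  proof -
    have "\<bar>F (x + s) - F x - s * c\<bar> = \<bar>s\<bar> * \<bar>(F (x + s) - F x) / s - c\<bar>"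
      unfolding abs_mult[symmetric] right_diff_distrib[of s "_ / _"] using that(1) by simp
    also have "\<dots> < \<bar>s\<bar> * \<epsilon>"
      using d(2)[OF that] that(1) by simp
    finally show ?thesis .
  qed
  with d(1) show ?thesis by blast
qed

theorem theorem3:
  fixes M :: "'w measure"
    and S :: "nat \<Rightarrow> 's measure"
    and nu :: "nat \<Rightarrow> 'w \<Rightarrow> 's measure"
    and H :: "nat \<Rightarrow> 'w \<Rightarrow> 's \<Rightarrow> real"
    and F :: "real \<Rightarrow> real"
    and \<beta> \<delta> :: real
  assumes "disordered_system M S nu H"
    and "\<beta> > 0" and "\<delta> > 0"
    and "\<And>\<beta>'. \<beta>' \<in> {\<beta> - \<delta><..<\<beta> + \<delta>} \<Longrightarrow>
      AE \<omega> in M. (\<lambda>N. free_energy nu H N \<beta>' \<omega>) \<longlonglongrightarrow> F \<beta>'"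
    and "F differentiable (at \<beta>)"
  shows "AE \<omega> in M.
    (\<lambda>N. gibbs_average nu H N \<beta> \<omega> (\<lambda>\<sigma>. \<bar>H N \<omega> \<sigma> / real N - deriv F \<beta>\<bar>)) \<longlonglongrightarrow> 0"
proof -
  interpret disordered_system M S nu H by fact
  \<comment> \<open>The offset 2 keeps \<open>s 0 = \<delta> / 2\<close> strictly below \<delta>, so
    that every shifted parameter lies in the open interval.\<close>
  define s where "s k = \<delta> / real (k + 2)" for k :: nat
  have s: "0 < s k" "s k < \<delta>" for k
    using \<open>\<delta> > 0\<close> by (auto simp: s_def field_simps intro: add_pos_nonneg)
  have "(\<lambda>k. \<delta> / real k) \<longlonglongrightarrow> 0"
    by (rule lim_const_over_n)
  then have s_lim: "s \<longlonglongrightarrow> 0"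
    unfolding s_def by (rule LIMSEQ_ignore_initial_segment)
  have deriv: "(F has_real_derivative deriv F \<beta>) (at \<beta>)"
    using assms(5) by (simp add: DERIV_deriv_iff_real_differentiable)
  have lim0: "AE \<omega> in M. (\<lambda>N. free_energy nu H N \<beta> \<omega>) \<longlonglongrightarrow> F \<beta>"
    using \<open>\<delta> > 0\<close> by (intro assms(4)) auto
  \<comment> \<open>The exceptional null set may vary with the parameter; a countable union of such
    sets is still null.\<close>
  have right: "AE \<omega> in M. \<forall>k. (\<lambda>N. free_energy nu H N (\<beta> + s k) \<omega>) \<longlonglongrightarrow> F (\<beta> + s k)"
  proof (subst AE_all_countable, intro allI assms(4))
    show "\<beta> + s k \<in> {\<beta> - \<delta><..<\<beta> + \<delta>}" for k using s[of k] by simp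
  qed
  have left: "AE \<omega> in M. \<forall>k. (\<lambda>N. free_energy nu H N (\<beta> - s k) \<omega>) \<longlonglongrightarrow> F (\<beta> - s k)"
  proof (subst AE_all_countable, intro allI assms(4))
    show "\<beta> - s k \<in> {\<beta> - \<delta><..<\<beta> + \<delta>}" for k using s[of k] by simp
  qed
  from AE_partition_function lim0 right left show ?thesis
  proof eventually_elim
    case (elim \<omega>)
    let ?G = "\<lambda>N. gibbs_average nu H N \<beta> \<omega> (\<lambda>\<sigma>. \<bar>H N \<omega> \<sigma> / real N - deriv F \<beta>\<bar>)"
    \<comment> \<open>This includes \<open>N = 0\<close> and the default values: integrals of
      nonnegative functions are nonnegative, and division by 0 gives 0.\<close>
    have nonneg: "?G N \<ge> 0" for N
      by (simp add: gibbs_average_def partition_function_def)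
    show ?case
    proof (rule order_tendstoI)
      show "\<forall>\<^sub>F N in sequentially. a < ?G N" if "a < 0" for a
        using that nonneg by (intro always_eventually allI) (rule less_le_trans)
    next
      fix a :: real
      assume "0 < a"
      then have "a / 2 > 0" by simp
      from has_real_derivative_increment_bound[OF deriv this]
      obtain d where d: "d > 0" "\<And>t. t \<noteq> 0 \<Longrightarrow> \<bar>t\<bar> < d \<Longrightarrow>
          \<bar>F (\<beta> + t) - F \<beta> - t * deriv F \<beta>\<bar> < \<bar>t\<bar> * (a / 2)"
        by blast
      \<comment> \<open>The index depends on \<open>a\<close> through \<open>d\<close>, but not on
        \<open>N\<close>.\<close>
      have "\<exists>k. s k < d"
        using order_tendstoD(2)[OF s_lim d(1)] by (auto simp: eventually_sequentially)
      then obtain k where k: "s k < d" ..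
      have "\<forall>\<^sub>F N in sequentially. ?G N < 2 * (a / 2)"
      proof (rule gibbs_average_abs_deviation_eventually_less[where s = "s k" and F = F])
        show "F (\<beta> + s k) - F \<beta> - s k * deriv F \<beta> < s k * (a / 2)"
          by (rule le_less_trans[OF abs_ge_self]) (use d(2)[of "s k"] s[of k] k in simp)
        show "F (\<beta> - s k) - F \<beta> + s k * deriv F \<beta> < s k * (a / 2)"
          by (rule le_less_trans[OF abs_ge_self]) (use d(2)[of "- s k"] s[of k] k in simp)
      qed (use elim s \<open>a / 2 > 0\<close> in auto)
      then show "\<forall>\<^sub>F N in sequentially. ?G N < a" by simp
    qed
  qed
qed

end
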